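(* Consider $\mathbf{\Sigma}=\mathbf{V}(\boldsymbol\theta_0)\in\mathrm{PDS}(k)$, for some vector $\boldsymbol\theta_0\in\mathbb{R}^\ell$ and linear variance structure $\mathbf{V}(\boldsymbol\theta)=\theta_1\mathbf{L}_1+\cdots+\theta_\ell\mathbf{L}_\ell$, and let $\mathbf{L}=[\mathrm{vec}(\mathbf{L}_1)\ \cdots\ \mathrm{vec}(\mathbf{L}_\ell)]$, which is of full column rank. Let $\{\mathbf{V}_n:n\ge1\}$ be a sequence of estimators for $\mathbf{\Sigma}$ and let $\{\boldsymbol\theta_n:n\ge1\}$ be a sequence of estimators for the vector $\boldsymbol\theta_0\in\mathbb{R}^\ell$ of variance components. Let $\sigma_1\ge0$ and $\sigma_2\ge-2\sigma_1/k$ be constants. (i) For $\mathbf{V}\in\mathrm{PDS}(k)$, let $H(\mathbf{V})\in\mathbb{R}^m$ be continuously differentiable and homogeneous of order zero. When $\sqrt{n}(\mathbf{V}_n-\mathbf{\Sigma})$ converges in distribution to a random matrix $\mathbf{M}$ that has a multivariate normal distribution with mean zero and variance $$\mathrm{var}\{\mathrm{vec}(\mathbf{M})\}=2\sigma_1\mathbf{L}\big(\mathbf{L}^T(\mathbf{\Sigma}^{-1}\otimes\mathbf{\Sigma}^{-1})\mathbf{L}\big)^{-1}\mathbf{L}^T+\sigma_2\,\mathrm{vec}(\mathbf{\Sigma})\mathrm{vec}(\mathbf{\Sigma})^T,$$ then $\sqrt{n}(H(\mathbf{V}_n)-H(\mathbf{\Sigma}))$ is asymptotically normal with mean zero and variance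 $$2\sigma_1\,H'(\mathbf{\Sigma})\,\mathbf{L}\big(\mathbf{L}^T(\mathbf{\Sigma}^{-1}\otimes\mathbf{\Sigma}^{-1})\mathbf{L}\big)^{-1}\mathbf{L}^T\,H'(\mathbf{\Sigma})^T .$$ (ii) When $\sqrt{n}(\boldsymbol\theta_n-\boldsymbol\theta_0)$ is asymptotically normal with mean zero and variance $$2\sigma_1\big(\mathbf{L}^T(\mathbf{\Sigma}^{-1}\otimes\mathbf{\Sigma}^{-1})\mathbf{L}\big)^{-1}+\sigma_2\,\boldsymbol\theta_0\boldsymbol\theta_0^T,$$ then for any mapping $H(\boldsymbol\theta)$ from $\mathbb{R}^\ell$ to $\mathbb{R}^m$ that is homogeneous of order zero, it holds that $\sqrt{n}(H(\boldsymbol\theta_n)-H(\boldsymbol\theta_0))$ is asymptotically normal with mean zero and variance $$2\sigma_1\,H'(\boldsymbol\theta_0)\big(\mathbf{L}^T(\mathbf{\Sigma}^{-1}\otimes\mathbf{\Sigma}^{-1})\mathbf{L}\big)^{-1}H'(\boldsymbol\theta_0)^T .$$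
   Context: $\mathrm{PDS}(k)$ is the class of positive definite symmetric $k\times k$ matrices; $\mathrm{vec}$ stacks the columns of a matrix; $\otimes$ is the Kronecker product. The covariance structure $\mathbf{V}(\cdot)$ is a known, symmetric-matrix-valued linear function of $\boldsymbol\theta=(\theta_1,\ldots,\theta_\ell)$, with $\mathbf{L}_j=\partial\mathbf{V}/\partial\theta_j$, so that $\mathrm{vec}(\mathbf{\Sigma})=\mathbf{L}\boldsymbol\theta_0$. A random matrix is multivariate normal if its $\mathrm{vec}$ is. "Asymptotically normal with mean zero and variance $\mathbf{A}$" means convergence in distribution to $N(\mathbf{0},\mathbf{A})$, where $\mathbf{A}$ may be singular. A mapping $H$ is homogeneous of order zero if $H(\alpha\mathbf{v})=H(\mathbf{v})$ for all $\alpha>0$. For a matrix argument, $H'(\mathbf{V})=\partial H(\mathbf{V})/\partial\,\mathrm{vec}(\mathbf{V})^T$ is the $m\times k^2$ matrix of partial derivatives with respect to the entries of $\mathbf{V}$. For a vector argument, $H'(\boldsymbol\theta)=\partial H(\boldsymbol\theta)/\partial\boldsymbol\theta^T$ is the $m\times\ell$ matrix of partial derivatives.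
   Formalization: In (ii) the mapping H, besides being homogeneous of order zero, is assumed (Fréchet) differentiable at θ₀ with H(θ_n) measurable; existence of the partial derivatives in H'(θ₀) alone would not suffice for the claim. *)

theory Defs
  imports "HOL-Probability.Probability"
begin

section \<open>Matrices\<close>

definition PDS :: "(real^'k^'k) set" where
  "PDS = {A. transpose A = A \<and> (\<forall>x. x \<noteq> 0 \<longrightarrow> 0 < x \<bullet> (A *v x))}"

text \<open>
  The entries of the column-stacked vector are indexed by pairs (column, row): the column is the
  outer (block) index.  The Kronecker product uses the matching index pairs (block, position in
  block); lemma \<open>kron_vec_mat\<close> below confirms that the two conventions agree.
\<close>

definition vec_mat :: "real^'c^'r \<Rightarrow> real^('c \<times> 'r)" where
  "vec_mat X = (\<chi> p. X $ snd p $ fst p)"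

definition kron :: "real^'b^'a \<Rightarrow> real^'d^'c \<Rightarrow> real^('b \<times> 'd)^('a \<times> 'c)" where
  "kron A B = (\<chi> p q. A $ fst p $ fst q * B $ snd p $ snd q)"

definition outer :: "real^'n \<Rightarrow> real^'m \<Rightarrow> real^'m^'n" where
  "outer v w = (\<chi> i j. v $ i * w $ j)"

lemma kron_vec_mat: "kron A B *v vec_mat X = vec_mat (B ** X ** transpose A)"
proof -
  have "(\<Sum>q\<in>UNIV. A $ a $ fst q * B $ b $ snd q * X $ snd q $ fst q)
      = (\<Sum>c\<in>UNIV. (\<Sum>d\<in>UNIV. B $ b $ d * X $ d $ c) * A $ a $ c)" for a b
    unfolding UNIV_Times_UNIV[symmetric] sum.cartesian_product'
    by (simp add: sum_distrib_left sum_distrib_right mult_ac)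
  then show ?thesis
    by (simp add: vec_eq_iff kron_def vec_mat_def matrix_vector_mult_def
        matrix_matrix_mult_def transpose_def)
qed

section \<open>Linear variance structures\<close>

definition lin_cov :: "('l \<Rightarrow> real^'k^'k) \<Rightarrow> real^'l \<Rightarrow> real^'k^'k" where
  "lin_cov Ls \<theta> = (\<Sum>j\<in>UNIV. \<theta> $ j *\<^sub>R Ls j)"

definition design :: "('l \<Rightarrow> real^'k^'k) \<Rightarrow> real^'l^('k \<times> 'k)" where
  "design Ls = (\<chi> p j. vec_mat (Ls j) $ p)"

lemma vec_mat_lin_cov: "vec_mat (lin_cov Ls \<theta>) = design Ls *v \<theta>"
  by (simp add: vec_eq_iff vec_mat_def lin_cov_def design_def matrix_vector_mult_def mult.commute)

section \<open>Normal laws and convergence in distribution\<close>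

definition normal_law :: "real \<Rightarrow> real \<Rightarrow> real measure" where
  "normal_law m v = (if v = 0 then return borel m else density lborel (normal_density m (sqrt v)))"

text \<open>
  A law on Euclidean space is normal if all its one-dimensional projections are normal; this
  includes singular variance matrices.
\<close>

definition multivariate_normal :: "(real^'n) measure \<Rightarrow> real^'n \<Rightarrow> real^'n^'n \<Rightarrow> bool" where
  "multivariate_normal N \<mu> A \<longleftrightarrow>
     prob_space N \<and> sets N = sets borel \<and>
     transpose A = A \<and> (\<forall>a. 0 \<le> a \<bullet> (A *v a)) \<and>
     (\<forall>a. distr N borel (\<lambda>x. a \<bullet> x) = normal_law (a \<bullet> \<mu>) (a \<bullet> (A *v a)))"

definition conv_in_distr ::
  "'w measure \<Rightarrow> (nat \<Rightarrow> 'w \<Rightarrow> 'a::topological_space) \<Rightarrow> 'a measure \<Rightarrow> bool" where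
  "conv_in_distr P X N \<longleftrightarrow>
     (\<forall>n. X n \<in> borel_measurable P) \<and>
     (\<forall>f :: 'a \<Rightarrow> real. continuous_on UNIV f \<longrightarrow> bounded (range f) \<longrightarrow>
        (\<lambda>n. \<integral>\<omega>. f (X n \<omega>) \<partial>P) \<longlonglongrightarrow> (\<integral>x. f x \<partial>N))"

definition asymptotically_normal ::
  "'w measure \<Rightarrow> (nat \<Rightarrow> 'w \<Rightarrow> real^'n) \<Rightarrow> real^'n^'n \<Rightarrow> bool" where
  "asymptotically_normal P X A \<longleftrightarrow> (\<exists>N. multivariate_normal N 0 A \<and> conv_in_distr P X N)"

section \<open>Homogeneous and differentiable maps\<close>

definition homogeneous_zero_on :: "'a::real_vector set \<Rightarrow> ('a \<Rightarrow> 'b) \<Rightarrow> bool" where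
  "homogeneous_zero_on S H \<longleftrightarrow> (\<forall>v\<in>S. \<forall>\<alpha>>0. H (\<alpha> *\<^sub>R v) = H v)"

text \<open>
  \<open>C1_on_PDS H H'\<close>: on the positive definite symmetric matrices, \<open>H\<close> is continuously differentiable
  with derivative matrix \<open>H' V\<close>, acting on the vectorised increment.  Since \<open>PDS\<close> is not open in
  the space of all matrices, the derivative is taken relative to \<open>PDS\<close>, and \<open>H' V\<close> is determined
  on symmetric increments.  If \<open>H\<close> is differentiable as a function of all entries, then the matrix
  \<open>entry_partials H V\<close> of partial derivatives with respect to the entries is an admissible \<open>H' V\<close>;
  see lemmas \<open>entry_partials_has_derivative\<close> and \<open>C1_on_PDS_entry_partials\<close>.
\<close>

definition C1_on_PDS :: "(real^'k^'k \<Rightarrow> real^'m) \<Rightarrow> (real^'k^'k \<Rightarrow> real^('k \<times> 'k)^'m) \<Rightarrow> bool" where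
  "C1_on_PDS H H' \<longleftrightarrow>
     (\<forall>V\<in>PDS. (H has_derivative (\<lambda>X. H' V *v vec_mat X)) (at V within PDS)) \<and>
     continuous_on PDS H'"

definition entry_partials :: "(real^'k^'k \<Rightarrow> real^'m) \<Rightarrow> real^'k^'k \<Rightarrow> real^('k \<times> 'k)^'m" where
  "entry_partials H V =
     (\<chi> i q. deriv (\<lambda>t. H (V + t *\<^sub>R axis (snd q) (axis (fst q) 1)) $ i) 0)"

lemma entry_partials_has_derivative:
  fixes H :: "real^'k^'k \<Rightarrow> real^'m"
  assumes "H differentiable (at V)"
  shows "(H has_derivative (\<lambda>X. entry_partials H V *v vec_mat X)) (at V)"
proof -
  from assms obtain D where D: "(H has_derivative D) (at V)"
    by (auto simp: differentiable_def)
  have lin: "linear D" using D by (rule has_derivative_linear)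
  have part: "entry_partials H V $ i $ q = D (axis (snd q) (axis (fst q) 1)) $ i"
    for i and q :: "'k \<times> 'k"
  proof -
    let ?E = "axis (snd q) (axis (fst q) (1::real)) :: real^'k^'k"
    have "((\<lambda>t. H (V + t *\<^sub>R ?E)) has_derivative (\<lambda>t. D (t *\<^sub>R ?E))) (at 0)"
    proof (rule has_derivative_compose[of "\<lambda>t. V + t *\<^sub>R ?E" "\<lambda>t. t *\<^sub>R ?E" 0 UNIV H D])
      show "((\<lambda>t. V + t *\<^sub>R ?E) has_derivative (\<lambda>t. t *\<^sub>R ?E)) (at 0)"
        by (auto intro!: derivative_eq_intros)
      show "(H has_derivative D) (at (V + 0 *\<^sub>R ?E))" using D by simp
    qed
    then have "((\<lambda>t. H (V + t *\<^sub>R ?E) $ i) has_derivative (\<lambda>t. D (t *\<^sub>R ?E) $ i)) (at 0)"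
      by (rule bounded_linear.has_derivative[OF bounded_linear_vec_nth])
    moreover have "(\<lambda>t. D (t *\<^sub>R ?E) $ i) = (*) (D ?E $ i)"
      by (auto simp: linear_scale[OF lin])
    ultimately have "DERIV (\<lambda>t. H (V + t *\<^sub>R ?E) $ i) 0 :> D ?E $ i"
      by (simp add: has_field_derivative_def)
    then show ?thesis by (simp add: entry_partials_def DERIV_imp_deriv)
  qed
  have "D X $ i = (entry_partials H V *v vec_mat X) $ i" for X i
  proof -
    have "X = (\<Sum>q\<in>UNIV. (X $ snd q $ fst q) *\<^sub>R axis (snd q) (axis (fst q) 1))"
      unfolding vec_eq_iff
    proof (intro allI)
      fix a b
      have "(\<Sum>q\<in>UNIV. (X $ snd q $ fst q) *\<^sub>R axis (snd q) (axis (fst q) (1::real))) $ a $ b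
        = (\<Sum>q\<in>UNIV. if q = (b, a) then X $ snd q $ fst q else 0)"
        unfolding sum_component
        by (intro sum.cong) (auto simp: axis_def prod_eq_iff)
      also have "\<dots> = X $ a $ b" by simp
      finally show "X $ a $ b =
        (\<Sum>q\<in>UNIV. (X $ snd q $ fst q) *\<^sub>R axis (snd q) (axis (fst q) (1::real))) $ a $ b" by simp
    qed
    then have "D X = D (\<Sum>q\<in>UNIV. (X $ snd q $ fst q) *\<^sub>R axis (snd q) (axis (fst q) 1))"
      by (rule arg_cong)
    also have "\<dots> = (\<Sum>q\<in>UNIV. (X $ snd q $ fst q) *\<^sub>R D (axis (snd q) (axis (fst q) 1)))"
      by (simp add: linear_sum[OF lin] linear_scale[OF lin])
    finally show ?thesis
      by (simp add: matrix_vector_mult_def part vec_mat_def mult.commute)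
  qed
  then have "D = (\<lambda>X. entry_partials H V *v vec_mat X)" by (auto simp: vec_eq_iff)
  with D show ?thesis by simp
qed

lemma C1_on_PDS_entry_partials:
  assumes "\<And>V. V \<in> PDS \<Longrightarrow> H differentiable (at V)" and "continuous_on PDS (entry_partials H)"
  shows "C1_on_PDS H (entry_partials H)"
  using assms entry_partials_has_derivative
  by (auto simp: C1_on_PDS_def intro: has_derivative_at_withinI)

end

theory Submission
  imports Defs
begin

text \<open>
  The delta method gives the limit law $H'(\Sigma)\,\mathrm{vec}(M)$.  By Euler's relation, the
  derivative of a map that is homogeneous of order zero annihilates the base point itself, so that
  the $\sigma_2$-term disappears from the limiting variance.
\<close>

section \<open>Euler's relation for maps of order zero\<close>

text \<open>Along the ray through \<open>v\<close> the map is constant, so its derivative in the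
  direction \<open>v\<close> vanishes. The hypothesis \<open>cone\<close> keeps the whole ray inside
  \<open>S\<close>, which lets a derivative relative to \<open>S\<close> be restricted to
  it.\<close>

lemma homogeneous_zero_derivative_eq_0:
  fixes H :: "'a::real_normed_vector \<Rightarrow> 'b::real_normed_vector"
  assumes hom: "homogeneous_zero_on S H"
    and D: "(H has_derivative D) (at v within S)"
    and cone: "\<And>\<alpha>. \<alpha> > 0 \<Longrightarrow> \<alpha> *\<^sub>R v \<in> S"
  shows "D v = 0"
proof -
  let ?c = "\<lambda>\<alpha>::real. \<alpha> *\<^sub>R v"
  have v: "v \<in> S" using cone[of 1] by simp
  have "((\<lambda>\<alpha>. H (?c \<alpha>)) has_derivative (\<lambda>t. D (t *\<^sub>R v))) (at 1 within {0<..})"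
  proof (rule has_derivative_in_compose[where f = ?c and g = H and g' = D])
    show "(?c has_derivative (\<lambda>t. t *\<^sub>R v)) (at 1 within {0<..})"
      by (auto intro!: derivative_eq_intros)
    show "(H has_derivative D) (at (1 *\<^sub>R v) within ?c ` {0<..})"
      using has_derivative_subset[OF D, of "?c ` {0<..}"] cone by auto
  qed
  moreover have "((\<lambda>\<alpha>. H (?c \<alpha>)) has_derivative (\<lambda>t. 0)) (at 1 within {0<..})"
    by (rule has_derivative_transform[where f = "\<lambda>_. H v"])
       (use hom v in \<open>auto simp: homogeneous_zero_on_def\<close>)
  \<comment> \<open>The parameter set \<open>{0<..}\<close> is open in the reals, so the derivative
    at 1 is unique there, even when \<open>S\<close> has empty interior.\<close>
  ultimately have "(\<lambda>t. D (t *\<^sub>R v)) = (\<lambda>t. 0)"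
    using has_derivative_unique by (simp add: at_within_open[of "1::real" "{0<..}"])
  from fun_cong[OF this, of 1] show ?thesis by simp
qed

section \<open>Symmetric perturbations of positive definite matrices\<close>

text \<open>Cauchy-Schwarz in each row suffices, since the norm on matrices is the Frobenius
  norm.\<close>

lemma norm_matrix_vector_mult_le:
  fixes A :: "real^'n^'m"
  shows "norm (A *v x) \<le> norm A * norm x"
proof -
  have "norm (A *v x) \<le> L2_set (\<lambda>i. norm (A $ i) * norm x) UNIV"
    unfolding norm_vec_def[of "A *v x"]
    by (rule L2_set_mono) (simp_all add: matrix_vector_mul_component Cauchy_Schwarz_ineq2)
  also have "\<dots> = norm A * norm x"
    unfolding norm_vec_def[of A] by (simp add: L2_set_left_distrib)
  finally show ?thesis .
qed

lemma PDS_scaleR: "A \<in> PDS \<Longrightarrow> c > 0 \<Longrightarrow> c *\<^sub>R A \<in> PDS"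
  by (auto simp: PDS_def transpose_scalar scaleR_matrix_vector_assoc[symmetric])

text \<open>\<open>PDS\<close> is open relative to the symmetric matrices: the quadratic form of
  \<open>A\<close> attains a positive minimum on the unit sphere, and this minimum serves as the
  radius \<open>r\<close>, since a perturbation of smaller norm moves the form on unit vectors by
  less than \<open>r\<close>.\<close>

lemma PDS_nhds_symmetric:
  fixes A :: "real^'k^'k"
  assumes A: "A \<in> PDS"
  obtains r where "r > 0" "\<And>B. transpose B = B \<Longrightarrow> dist B A < r \<Longrightarrow> B \<in> PDS"
proof -
  have ne: "sphere 0 1 \<noteq> ({} :: (real^'k) set)" by simp
  have cont: "continuous_on (sphere 0 1) (\<lambda>x. x \<bullet> (A *v x))"
    by (intro continuous_intros)
  obtain u where u: "u \<in> sphere 0 1" "\<And>x. x \<in> sphere 0 1 \<Longrightarrow> u \<bullet> (A *v u) \<le> x \<bullet> (A *v x)"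
    using continuous_attains_inf[OF compact_sphere ne cont] by auto
  define r where "r = u \<bullet> (A *v u)"
  have "u \<noteq> 0" using u(1) by auto
  then have "r > 0" using A by (simp add: PDS_def r_def)
  moreover have "B \<in> PDS" if sym: "transpose B = B" and B: "dist B A < r" for B
  proof -
    have "0 < x \<bullet> (B *v x)" if "x \<noteq> 0" for x
    proof -
      define y where "y = x /\<^sub>R norm x"
      have y: "norm y = 1" "x = norm x *\<^sub>R y" using that by (auto simp: y_def)
      have "\<bar>y \<bullet> ((B - A) *v y)\<bar> \<le> norm y * norm ((B - A) *v y)"
        by (rule Cauchy_Schwarz_ineq2)
      also have "\<dots> < r"
        using norm_matrix_vector_mult_le[of "B - A" y] B y by (simp add: dist_norm)
      finally have "\<bar>y \<bullet> ((B - A) *v y)\<bar> < r" .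
      moreover have "r \<le> y \<bullet> (A *v y)" using u(2) y by (simp add: r_def)
      ultimately have "0 < y \<bullet> (B *v y)"
        by (simp add: matrix_vector_mult_diff_rdistrib inner_diff_right)
      moreover have "x \<bullet> (B *v x) = norm x * (norm x * (y \<bullet> (B *v y)))"
        by (subst (1 2) y(2)) (simp add: matrix_vector_mult_scaleR)
      ultimately show ?thesis using that by simp
    qed
    with sym show ?thesis by (simp add: PDS_def)
  qed
  ultimately show ?thesis using that by blast
qed

section \<open>Linear images of normal laws\<close>

text \<open>Projecting \<open>B *v x\<close> on \<open>a\<close> amounts to projecting
  \<open>x\<close> on \<open>transpose B *v a\<close>, so normality of all one-dimensional
  projections carries over. No density enters, so singular variances are covered.\<close>

lemma multivariate_normal_linear_image:
  fixes B :: "real^'n^'m"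
  assumes N: "multivariate_normal N 0 A"
  shows "multivariate_normal (distr N borel ((*v) B)) 0 (B ** A ** transpose B)"
proof -
  interpret N: prob_space N using N by (simp add: multivariate_normal_def)
  have sets: "sets N = sets borel" using N by (simp add: multivariate_normal_def)
  have meas: "(*v) B \<in> borel_measurable N"
    unfolding measurable_cong_sets[OF sets refl]
    by (intro borel_measurable_continuous_onI continuous_intros)
  have meas': "(\<lambda>x. a \<bullet> x) \<in> borel_measurable borel" for a :: "real^'m" by simp
  have adj: "a \<bullet> (B *v x) = (transpose B *v a) \<bullet> x" for a x
    by (simp add: dot_lmul_matrix[symmetric])
  have quad: "a \<bullet> ((B ** A ** transpose B) *v a) = (transpose B *v a) \<bullet> (A *v (transpose B *v a))" for a
    by (simp add: matrix_vector_mul_assoc[symmetric] adj)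
  have "prob_space (distr N borel ((*v) B))" by (rule N.prob_space_distr[OF meas])
  moreover have "transpose (B ** A ** transpose B) = B ** A ** transpose B"
    using N by (simp add: multivariate_normal_def matrix_transpose_mul matrix_mul_assoc)
  moreover have "distr (distr N borel ((*v) B)) borel (\<lambda>x. a \<bullet> x) =
      normal_law 0 (a \<bullet> ((B ** A ** transpose B) *v a))" for a
    using N by (simp only: distr_distr[OF meas' meas] o_def adj quad)
      (simp add: multivariate_normal_def)
  ultimately show ?thesis
    using N by (simp add: multivariate_normal_def quad)
qed

section \<open>The delta method relative to a set\<close>

text \<open>The integrand is a continuous stand-in for the indicator of \<open>norm x > k\<close>,
  so that it can also be used as a test function for convergence in distribution. At each point it
  is eventually zero, and dominated convergence applies.\<close>

lemma prob_space_tail_expectation_tendsto_0: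
  fixes N :: "'a::euclidean_space measure"
  assumes "prob_space N" and sets: "sets N = sets borel"
  shows "(\<lambda>k. \<integral>x. min 1 (max 0 (norm x - real k)) \<partial>N) \<longlonglongrightarrow> 0"
proof -
  interpret N: prob_space N by fact
  have "(\<lambda>k. \<integral>x. min 1 (max 0 (norm x - real k)) \<partial>N) \<longlonglongrightarrow> (\<integral>x. 0 \<partial>N)"
  proof (rule integral_dominated_convergence[where w = "\<lambda>_. 1"])
    show "(\<lambda>x. min 1 (max 0 (norm x - real k))) \<in> borel_measurable N" for k
      unfolding measurable_cong_sets[OF sets refl] by measurable
    show "AE x in N. (\<lambda>k. min 1 (max 0 (norm x - real k))) \<longlonglongrightarrow> 0"
    proof (intro AE_I2 tendsto_eventually)
      fix x :: 'a
      obtain K where "norm x \<le> real K" using real_arch_simple by blast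
      then show "\<forall>\<^sub>F k in sequentially. min 1 (max 0 (norm x - real k)) = 0"
        by (intro eventually_sequentiallyI[of K]) auto
    qed
  qed auto
  then show ?thesis by simp
qed

text \<open>
  Convergence in law of the rescaled estimators makes them tight: up to small expectation they stay
  in a ball, on which the linearisation error is uniformly small and the test function is uniformly
  continuous.  Only a neighbourhood of the base point matters, so differentiability within \<open>S\<close>
  suffices when estimates close to it lie in \<open>S\<close>.
\<close>

lemma delta_method:
  fixes T :: "nat \<Rightarrow> 'w \<Rightarrow> 'a::euclidean_space" and H :: "'a \<Rightarrow> 'b::euclidean_space"
  assumes P: "prob_space P" and N: "prob_space N" "sets N = sets borel"
    and conv: "conv_in_distr P (\<lambda>n \<omega>. sqrt (real n) *\<^sub>R (T n \<omega> - x\<^sub>0)) N"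
    and D: "(H has_derivative D) (at x\<^sub>0 within S)"
    and r: "r > 0" and S: "\<And>n. n \<ge> 1 \<Longrightarrow> AE \<omega> in P. dist (T n \<omega>) x\<^sub>0 < r \<longrightarrow> T n \<omega> \<in> S"
    and meas: "\<And>n. n \<ge> 1 \<Longrightarrow> (\<lambda>\<omega>. H (T n \<omega>)) \<in> borel_measurable P"
  shows "conv_in_distr P (\<lambda>n \<omega>. sqrt (real n) *\<^sub>R (H (T n \<omega>) - H x\<^sub>0)) (distr N borel D)"
proof -
  interpret P: prob_space P by fact
  define X where "X = (\<lambda>n \<omega>. sqrt (real n) *\<^sub>R (T n \<omega> - x\<^sub>0))"
  define Y where "Y = (\<lambda>n \<omega>. sqrt (real n) *\<^sub>R (H (T n \<omega>) - H x\<^sub>0))"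
  have X_meas: "X n \<in> borel_measurable P" for n
    using conv by (simp add: conv_in_distr_def X_def)
  have X_conv: "(\<lambda>n. \<integral>\<omega>. f (X n \<omega>) \<partial>P) \<longlonglongrightarrow> (\<integral>x. f x \<partial>N)"
    if "continuous_on UNIV f" "bounded (range f)" for f :: "'a \<Rightarrow> real"
    using conv that by (simp add: conv_in_distr_def X_def)
  \<comment> \<open>At index 0 the factor \<open>sqrt 0\<close> makes \<open>Y 0\<close> identically
    zero; \<open>meas\<close> covers the indices from 1 on.\<close>
  have Y_meas: "Y n \<in> borel_measurable P" for n
    using meas[of n] by (cases "n = 0") (auto simp: Y_def)
  have blD: "bounded_linear D" using D by (rule has_derivative_bounded_linear)
  then have D_cont: "continuous_on UNIV D" by (rule linear_continuous_on)
  then have D_meas: "D \<in> borel_measurable borel" by (rule borel_measurable_continuous_onI)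
  have "(\<lambda>n. \<integral>\<omega>. f (Y n \<omega>) \<partial>P) \<longlonglongrightarrow> (\<integral>x. f x \<partial>distr N borel D)"
    if f: "continuous_on UNIV f" and bdd: "bounded (range f)" for f :: "'b \<Rightarrow> real"
  proof -
    have f_meas: "f \<in> borel_measurable borel" using f by (rule borel_measurable_continuous_onI)
    obtain B where B: "B > 0" "\<And>x. \<bar>f x\<bar> \<le> B"
      using bdd by (force simp: bounded_pos)
    have int_bdd: "integrable P (\<lambda>\<omega>. g (Z \<omega>))"
      if "Z \<in> borel_measurable P" "g \<in> borel_measurable borel" "\<And>x. \<bar>g x\<bar> \<le> C"
      for g :: "'c::euclidean_space \<Rightarrow> real" and Z C
      using that by (intro P.integrable_const_bound[where B = C]) auto
    \<comment> \<open>Composing \<open>f\<close> with the continuous map \<open>D\<close> gives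
      another bounded continuous test function. It then remains to compare the expectations of
      \<open>f (Y n \<omega>)\<close> and \<open>f (D (X n \<omega>))\<close>.\<close>
    have lim_DX: "(\<lambda>n. \<integral>\<omega>. f (D (X n \<omega>)) \<partial>P) \<longlonglongrightarrow> (\<integral>x. f (D x) \<partial>N)"
    proof (rule X_conv)
      show "continuous_on UNIV (\<lambda>x. f (D x))"
        by (rule continuous_on_compose2[OF f D_cont]) simp
      show "bounded (range (\<lambda>x. f (D x)))"
        using B by (auto simp: bounded_iff)
    qed
    have "(\<lambda>n. (\<integral>\<omega>. f (Y n \<omega>) \<partial>P) - (\<integral>\<omega>. f (D (X n \<omega>)) \<partial>P)) \<longlonglongrightarrow> 0"
    proof (rule LIMSEQ_I)
      fix e :: real assume e: "e > 0"
      define g where "g k x = min 1 (max 0 (norm x - real k))" for k :: nat and x :: 'a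
      have g_meas: "g k \<in> borel_measurable borel" for k unfolding g_def by measurable
      have g_range: "0 \<le> g k x" "\<bar>g k x\<bar> \<le> 1" for k x by (auto simp: g_def)
      have "(\<lambda>k. \<integral>x. g k x \<partial>N) \<longlonglongrightarrow> 0"
        unfolding g_def by (rule prob_space_tail_expectation_tendsto_0[OF N])
      \<comment> \<open>The tolerance is split in half: on the tail the two values of
        \<open>f\<close> differ by at most \<open>2 * B\<close>, so a tail expectation below
        \<open>e / (4 * B)\<close> costs less than \<open>e / 2\<close>.\<close>
      from order_tendstoD(2)[OF this, of "e / (4 * B)"] e B
      obtain k where k: "(\<integral>x. g k x \<partial>N) < e / (4 * B)"
        by (auto simp: eventually_sequentially)
      \<comment> \<open>Continuity of the cutoff carries the tail bound from \<open>N\<close> over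
        to the laws of \<open>X n\<close> for all large \<open>n\<close>; this is the tightness used
        below.\<close>
      have "(\<lambda>n. \<integral>\<omega>. g k (X n \<omega>) \<partial>P) \<longlonglongrightarrow> (\<integral>x. g k x \<partial>N)"
      proof (rule X_conv)
        show "continuous_on UNIV (g k)" unfolding g_def by (intro continuous_intros)
        show "bounded (range (g k))" using g_range(2)[of k] unfolding bounded_iff by auto
      qed
      from order_tendstoD(2)[OF this k] obtain n1
        where n1: "\<And>n. n \<ge> n1 \<Longrightarrow> (\<integral>\<omega>. g k (X n \<omega>) \<partial>P) < e / (4 * B)"
        by (auto simp: eventually_sequentially)
      \<comment> \<open>The cutoff \<open>g k\<close> equals 1 from norm \<open>k + 1\<close> on, so
        outside radius \<open>R\<close> it absorbs the crude bound \<open>2 * B\<close>.\<close>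
      define R where "R = real k + 1"
      have R: "R > 0" by (simp add: R_def)
      obtain K where K: "K > 0" "\<And>x. norm (D x) \<le> norm x * K"
        using bounded_linear.pos_bounded[OF blD] by blast
      \<comment> \<open>When \<open>X n \<omega>\<close> has norm below \<open>R\<close>,
        \<open>D (X n \<omega>)\<close> has norm at most \<open>R * K\<close>, and
        \<open>Y n \<omega>\<close> will lie within distance 1 of it.\<close>
      have "uniformly_continuous_on (cball 0 (R * K + 1)) f"
        by (rule compact_uniformly_continuous) (use f continuous_on_subset in auto)
      then obtain d where d: "d > 0" "\<And>x y. \<lbrakk>x \<in> cball 0 (R * K + 1); y \<in> cball 0 (R * K + 1); dist y x < d\<rbrakk>
          \<Longrightarrow> dist (f y) (f x) < e / 2"
        unfolding uniformly_continuous_on_def using e by (meson half_gt_zero)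
      \<comment> \<open>With this choice \<open>\<eta> * R\<close> is half of
        \<open>min d 1\<close>: below \<open>d\<close> for uniform continuity, and below 1 for
        staying in the enlarged ball.\<close>
      define \<eta> where "\<eta> = min d 1 / (2 * R)"
      have \<eta>: "\<eta> > 0" "\<eta> * R < d" "\<eta> * R < 1" using d R by (auto simp: \<eta>_def)
      obtain s where s: "s > 0" "\<And>y. \<lbrakk>y \<in> S; norm (y - x\<^sub>0) < s\<rbrakk>
          \<Longrightarrow> norm (H y - H x\<^sub>0 - D (y - x\<^sub>0)) \<le> \<eta> * norm (y - x\<^sub>0)"
        using D \<eta>(1) unfolding has_derivative_within_alt by blast
      have "filterlim (\<lambda>n. sqrt (real n)) at_top sequentially"
        by (intro filterlim_compose[OF sqrt_at_top] filterlim_real_sequentially)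
      \<comment> \<open>For such \<open>n\<close>, a norm of \<open>X n \<omega>\<close> below
        \<open>R\<close> forces \<open>T n \<omega>\<close> within \<open>min s r\<close> of
        \<open>x\<^sub>0\<close>: \<open>r\<close> puts it into \<open>S\<close>, and
        \<open>s\<close> activates the linearisation bound.\<close>
      then have "\<forall>\<^sub>F n in sequentially. R / min s r < sqrt (real n)"
        by (simp add: filterlim_at_top_dense)
      then obtain n2 where n2: "\<And>n. n \<ge> n2 \<Longrightarrow> R / min s r < sqrt (real n)"
        by (auto simp: eventually_sequentially)
      have bound: "\<bar>f (Y n \<omega>) - f (D (X n \<omega>))\<bar> \<le> e / 2 + 2 * B * g k (X n \<omega>)"
        if n: "n \<ge> n2" and \<omega>: "dist (T n \<omega>) x\<^sub>0 < r \<longrightarrow> T n \<omega> \<in> S" for n \<omega>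
      proof (cases "norm (X n \<omega>) < R")
        case True
        have sn: "R / min s r < sqrt (real n)" using n2[OF n] .
        have sn0: "sqrt (real n) > 0"
          using sn divide_pos_pos[of R "min s r"] R s r by linarith
        let ?h = "T n \<omega> - x\<^sub>0"
        have "norm ?h = norm (X n \<omega>) / sqrt (real n)" using sn0 by (simp add: X_def)
        also have "\<dots> < R / sqrt (real n)" using True sn0 by (simp add: divide_strict_right_mono)
        also have "\<dots> < min s r" using sn sn0 s(1) r by (simp add: pos_divide_less_eq mult.commute del: min_less_iff_conj)
        finally have h: "norm ?h < s" "norm ?h < r" by auto
        \<comment> \<open>Linearity of \<open>D\<close> pulls out \<open>sqrt (real n)\<close>, so
          the error is the rescaled remainder of the linearisation.\<close>
        have "Y n \<omega> - D (X n \<omega>) = sqrt (real n) *\<^sub>R (H (T n \<omega>) - H x\<^sub>0 - D ?h)"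
          by (simp only: X_def Y_def scaleR_diff_right[of _ "_ - _" "D _"]
              linear_scale[OF bounded_linear.linear[OF blD]])
        then have "norm (Y n \<omega> - D (X n \<omega>)) = sqrt (real n) * norm (H (T n \<omega>) - H x\<^sub>0 - D ?h)"
          by simp
        also have "\<dots> \<le> sqrt (real n) * (\<eta> * norm ?h)"
          using s(2)[of "T n \<omega>"] h \<omega> by (intro mult_left_mono) (auto simp: dist_norm)
        also have "\<dots> = \<eta> * norm (X n \<omega>)" by (simp add: X_def)
        also have "\<dots> \<le> \<eta> * R" using True \<eta> by simp
        finally have YD: "norm (Y n \<omega> - D (X n \<omega>)) \<le> \<eta> * R" .
        have DX: "norm (D (X n \<omega>)) \<le> R * K"
          using K(2)[of "X n \<omega>"] True K(1) mult_right_mono[of "norm (X n \<omega>)" R K] by linarith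
        have "norm (Y n \<omega>) \<le> R * K + 1"
          using YD DX \<eta> norm_triangle_sub[of "Y n \<omega>" "D (X n \<omega>)"] by linarith
        then have "dist (f (Y n \<omega>)) (f (D (X n \<omega>))) < e / 2"
          using YD DX \<eta> by (intro d(2)) (auto simp: dist_norm)
        then show ?thesis
          using B(1) g_range(1)[of k "X n \<omega>"] by (simp add: dist_real_def add_increasing2)
      next
        case False
        then have "g k (X n \<omega>) = 1" by (simp add: g_def R_def)
        then show ?thesis using B(2)[of "Y n \<omega>"] B(2)[of "D (X n \<omega>)"] e by simp
      qed
      \<comment> \<open>The 1 in the maximum excludes index 0, about which \<open>S\<close> says
        nothing.\<close>
      have "norm ((\<integral>\<omega>. f (Y n \<omega>) \<partial>P) - (\<integral>\<omega>. f (D (X n \<omega>)) \<partial>P) - 0) < e"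
        if n: "n \<ge> max 1 (max n1 n2)" for n
      proof -
        have iY: "integrable P (\<lambda>\<omega>. f (Y n \<omega>))"
          using Y_meas f_meas B(2) by (rule int_bdd)
        have iX: "integrable P (\<lambda>\<omega>. f (D (X n \<omega>)))"
          using measurable_compose[OF X_meas D_meas] f_meas B(2) by (rule int_bdd)
        have ig: "integrable P (\<lambda>\<omega>. g k (X n \<omega>))"
          using X_meas g_meas g_range(2) by (rule int_bdd)
        have "\<bar>(\<integral>\<omega>. f (Y n \<omega>) \<partial>P) - (\<integral>\<omega>. f (D (X n \<omega>)) \<partial>P)\<bar>
            = \<bar>\<integral>\<omega>. f (Y n \<omega>) - f (D (X n \<omega>)) \<partial>P\<bar>"
          using iX iY by simp
        also have "\<dots> \<le> (\<integral>\<omega>. \<bar>f (Y n \<omega>) - f (D (X n \<omega>))\<bar> \<partial>P)" by (rule integral_abs_bound)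
        also have "\<dots> \<le> (\<integral>\<omega>. e / 2 + 2 * B * g k (X n \<omega>) \<partial>P)"
        proof (rule integral_mono_AE)
          show "AE \<omega> in P. \<bar>f (Y n \<omega>) - f (D (X n \<omega>))\<bar> \<le> e / 2 + 2 * B * g k (X n \<omega>)"
            using S[of n] n by (auto intro: bound)
        qed (use iX iY ig in auto)
        also have "\<dots> = e / 2 + 2 * B * (\<integral>\<omega>. g k (X n \<omega>) \<partial>P)"
          using ig by (simp add: P.prob_space)
        also have "\<dots> < e / 2 + 2 * B * (e / (4 * B))"
          using n1[of n] n B(1) by (intro add_strict_left_mono mult_strict_left_mono) auto
        also have "\<dots> = e" using B(1) by (simp add: field_simps)
        finally show ?thesis by simp
      qed
      then show "\<exists>n0. \<forall>n\<ge>n0. norm ((\<integral>\<omega>. f (Y n \<omega>) \<partial>P) - (\<integral>\<omega>. f (D (X n \<omega>)) \<partial>P) - 0) < e"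
        by blast
    qed
    from tendsto_add[OF this lim_DX] have "(\<lambda>n. \<integral>\<omega>. f (Y n \<omega>) \<partial>P) \<longlonglongrightarrow> (\<integral>x. f (D x) \<partial>N)"
      by simp
    moreover have "(\<integral>x. f x \<partial>distr N borel D) = (\<integral>x. f (D x) \<partial>N)"
      using D_meas f_meas by (intro integral_distr) (simp_all add: measurable_cong_sets[OF N(2) refl])
    ultimately show ?thesis by simp
  qed
  with Y_meas show ?thesis by (simp add: conv_in_distr_def Y_def)
qed

section \<open>Limit laws without the rank-one term\<close>

text \<open>\<open>outer v v\<close> is \<open>v\<close> times its transpose, so \<open>B\<close>
  turns it into the outer product of \<open>B *v v\<close> with \<open>v\<close>, which is zero. In
  this form Euler's relation removes the \<open>\<sigma>\<^sub>2\<close> term from the limiting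
  variance.\<close>

lemma congruence_annihilates_outer:
  fixes B :: "real^'n^'m"
  assumes "B *v v = 0"
  shows "B ** (c *\<^sub>R A + d *\<^sub>R outer v v) ** transpose B = c *\<^sub>R (B ** A ** transpose B)"
proof -
  have "B ** outer v v = outer (B *v v) v"
    by (simp add: vec_eq_iff matrix_matrix_mult_def outer_def matrix_vector_mult_def
        sum_distrib_right mult.assoc)
  also have "\<dots> = 0" using assms by (simp add: outer_def vec_eq_iff)
  finally show ?thesis
    by (simp add: matrix_add_ldistrib matrix_scalar_ac flip: scalar_matrix_assoc)
qed

text \<open>Convergence in distribution includes measurability. Values of \<open>V n\<close> may lie
  outside \<open>PDS\<close>, where \<open>C1_on_PDS\<close> does not control \<open>H\<close>, and
  in the second part \<open>H\<close> is differentiable at a single point; measurability of the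
  composed maps is therefore a hypothesis in both parts.\<close>

theorem theorem3:
  fixes P :: "'w measure" and Q :: "'q measure"
    and Ls :: "'l::finite \<Rightarrow> real^'k^'k" and L :: "real^'l^('k \<times> 'k)"
    and \<theta>\<^sub>0 :: "real^'l" and \<Sigma> :: "real^'k^'k" and G :: "real^'l^'l"
    and V :: "nat \<Rightarrow> 'w \<Rightarrow> real^'k^'k" and \<theta> :: "nat \<Rightarrow> 'w \<Rightarrow> real^'l"
    and M :: "'q \<Rightarrow> real^'k^'k"
    and \<sigma>\<^sub>1 \<sigma>\<^sub>2 :: real
  assumes "\<And>j. transpose (Ls j) = Ls j"
    and "\<Sigma> = lin_cov Ls \<theta>\<^sub>0" and "\<Sigma> \<in> PDS"
    and "L = design Ls" and "rank L = CARD('l)"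
    and "G = transpose L ** kron (matrix_inv \<Sigma>) (matrix_inv \<Sigma>) ** L"
    and "prob_space P"
    and "\<And>n. n \<ge> 1 \<Longrightarrow> V n \<in> borel_measurable P"
    and "\<And>n. n \<ge> 1 \<Longrightarrow> AE \<omega> in P. transpose (V n \<omega>) = V n \<omega>"
    and "\<And>n. n \<ge> 1 \<Longrightarrow> \<theta> n \<in> borel_measurable P"
    and "\<sigma>\<^sub>1 \<ge> 0" and "\<sigma>\<^sub>2 \<ge> - 2 * \<sigma>\<^sub>1 / real CARD('k)"
  shows
    "(\<forall>(H :: real^'k^'k \<Rightarrow> real^'m) H'.
        C1_on_PDS H H' \<longrightarrow> homogeneous_zero_on PDS H \<longrightarrow>
        (\<forall>n\<ge>1. (\<lambda>\<omega>. H (V n \<omega>)) \<in> borel_measurable P) \<longrightarrow>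
        prob_space Q \<longrightarrow> M \<in> borel_measurable Q \<longrightarrow>
        multivariate_normal (distr Q borel (\<lambda>\<omega>. vec_mat (M \<omega>))) 0
          ((2 * \<sigma>\<^sub>1) *\<^sub>R (L ** matrix_inv G ** transpose L)
            + \<sigma>\<^sub>2 *\<^sub>R outer (vec_mat \<Sigma>) (vec_mat \<Sigma>)) \<longrightarrow>
        conv_in_distr P (\<lambda>n \<omega>. sqrt (real n) *\<^sub>R (V n \<omega> - \<Sigma>)) (distr Q borel M) \<longrightarrow>
        asymptotically_normal P (\<lambda>n \<omega>. sqrt (real n) *\<^sub>R (H (V n \<omega>) - H \<Sigma>))
          ((2 * \<sigma>\<^sub>1) *\<^sub>R (H' \<Sigma> ** L ** matrix_inv G ** transpose L ** transpose (H' \<Sigma>))))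
     \<and>
     (asymptotically_normal P (\<lambda>n \<omega>. sqrt (real n) *\<^sub>R (\<theta> n \<omega> - \<theta>\<^sub>0))
        ((2 * \<sigma>\<^sub>1) *\<^sub>R matrix_inv G + \<sigma>\<^sub>2 *\<^sub>R outer \<theta>\<^sub>0 \<theta>\<^sub>0) \<longrightarrow>
      (\<forall>H :: real^'l \<Rightarrow> real^'m.
        homogeneous_zero_on UNIV H \<longrightarrow> H differentiable (at \<theta>\<^sub>0) \<longrightarrow>
        (\<forall>n\<ge>1. (\<lambda>\<omega>. H (\<theta> n \<omega>)) \<in> borel_measurable P) \<longrightarrow>
        asymptotically_normal P (\<lambda>n \<omega>. sqrt (real n) *\<^sub>R (H (\<theta> n \<omega>) - H \<theta>\<^sub>0))
          ((2 * \<sigma>\<^sub>1) *\<^sub>R (jacobian H (at \<theta>\<^sub>0) ** matrix_inv G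
             ** transpose (jacobian H (at \<theta>\<^sub>0))))))"
proof (intro conjI allI impI)
  fix H :: "real^'k^'k \<Rightarrow> real^'m" and H'
  assume C1: "C1_on_PDS H H'" and hom: "homogeneous_zero_on PDS H"
    and meas: "\<forall>n\<ge>1. (\<lambda>\<omega>. H (V n \<omega>)) \<in> borel_measurable P"
    and Q: "prob_space Q" and M: "M \<in> borel_measurable Q"
    and normal: "multivariate_normal (distr Q borel (\<lambda>\<omega>. vec_mat (M \<omega>))) 0
          ((2 * \<sigma>\<^sub>1) *\<^sub>R (L ** matrix_inv G ** transpose L)
            + \<sigma>\<^sub>2 *\<^sub>R outer (vec_mat \<Sigma>) (vec_mat \<Sigma>))"
    and conv: "conv_in_distr P (\<lambda>n \<omega>. sqrt (real n) *\<^sub>R (V n \<omega> - \<Sigma>)) (distr Q borel M)"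
  let ?D = "\<lambda>X. H' \<Sigma> *v vec_mat X"
  have D: "(H has_derivative ?D) (at \<Sigma> within PDS)"
    using C1 assms(3) by (simp add: C1_on_PDS_def)
  \<comment> \<open>\<open>PDS\<close> is closed under positive scaling, so the ray through
    \<open>\<Sigma>\<close> stays in it.\<close>
  have Euler: "H' \<Sigma> *v vec_mat \<Sigma> = 0"
    by (rule homogeneous_zero_derivative_eq_0[OF hom D]) (rule PDS_scaleR[OF assms(3)])
  obtain r where r: "r > 0" "\<And>B. transpose B = B \<Longrightarrow> dist B \<Sigma> < r \<Longrightarrow> B \<in> PDS"
    by (rule PDS_nhds_symmetric[OF assms(3)]) blast
  have "conv_in_distr P (\<lambda>n \<omega>. sqrt (real n) *\<^sub>R (H (V n \<omega>) - H \<Sigma>))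
      (distr (distr Q borel M) borel ?D)"
  proof (rule delta_method[OF assms(7) _ _ conv D r(1)])
    show "prob_space (distr Q borel M)" using Q M by (rule prob_space.prob_space_distr)
    \<comment> \<open>Estimators that are almost surely symmetric are positive definite as soon as
      they are close to \<open>\<Sigma>\<close>, so the derivative relative to \<open>PDS\<close>
      applies to them.\<close>
    show "AE \<omega> in P. dist (V n \<omega>) \<Sigma> < r \<longrightarrow> V n \<omega> \<in> PDS" if "n \<ge> 1" for n
      using assms(9)[OF that] by eventually_elim (blast intro: r(2))
  qed (use meas in auto)
  \<comment> \<open>The delta method yields an image of the law of \<open>M\<close>, while normality
    is given for the vectorised \<open>M\<close>; both sides are the law of
    \<open>H' \<Sigma> *v vec_mat (M \<omega>)\<close>.\<close>
  moreover have "distr (distr Q borel M) borel ?D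
      = distr (distr Q borel (\<lambda>\<omega>. vec_mat (M \<omega>))) borel ((*v) (H' \<Sigma>))"
  proof -
    have "continuous_on UNIV (vec_mat :: real^'k^'k \<Rightarrow> _)"
      unfolding vec_mat_def by (intro continuous_intros)
    then have vm: "(vec_mat :: real^'k^'k \<Rightarrow> _) \<in> borel_measurable borel"
      by (rule borel_measurable_continuous_onI)
    have mv: "(*v) (H' \<Sigma>) \<in> borel_measurable borel"
      by (intro borel_measurable_continuous_onI continuous_intros)
    show ?thesis
      using distr_distr[OF measurable_compose[OF vm mv] M]
        distr_distr[OF mv measurable_compose[OF M vm]]
      by (simp add: o_def)
  qed
  moreover have "multivariate_normal \<dots> 0
      ((2 * \<sigma>\<^sub>1) *\<^sub>R (H' \<Sigma> ** L ** matrix_inv G ** transpose L ** transpose (H' \<Sigma>)))"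
    using multivariate_normal_linear_image[OF normal, of "H' \<Sigma>"]
    by (simp only: congruence_annihilates_outer[OF Euler] matrix_mul_assoc)
  ultimately show "asymptotically_normal P (\<lambda>n \<omega>. sqrt (real n) *\<^sub>R (H (V n \<omega>) - H \<Sigma>))
          ((2 * \<sigma>\<^sub>1) *\<^sub>R (H' \<Sigma> ** L ** matrix_inv G ** transpose L ** transpose (H' \<Sigma>)))"
    unfolding asymptotically_normal_def by (intro exI conjI) simp_all
next
  fix H :: "real^'l \<Rightarrow> real^'m"
  assume an: "asymptotically_normal P (\<lambda>n \<omega>. sqrt (real n) *\<^sub>R (\<theta> n \<omega> - \<theta>\<^sub>0))
        ((2 * \<sigma>\<^sub>1) *\<^sub>R matrix_inv G + \<sigma>\<^sub>2 *\<^sub>R outer \<theta>\<^sub>0 \<theta>\<^sub>0)"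
    and hom: "homogeneous_zero_on UNIV H" and diff: "H differentiable (at \<theta>\<^sub>0)"
    and meas: "\<forall>n\<ge>1. (\<lambda>\<omega>. H (\<theta> n \<omega>)) \<in> borel_measurable P"
  let ?J = "jacobian H (at \<theta>\<^sub>0)"
  have D: "(H has_derivative (*v) ?J) (at \<theta>\<^sub>0)"
    using diff by (rule jacobian_works[THEN iffD1])
  have Euler: "?J *v \<theta>\<^sub>0 = 0"
    by (rule homogeneous_zero_derivative_eq_0[OF hom D]) simp
  obtain N where N: "multivariate_normal N 0 ((2 * \<sigma>\<^sub>1) *\<^sub>R matrix_inv G + \<sigma>\<^sub>2 *\<^sub>R outer \<theta>\<^sub>0 \<theta>\<^sub>0)"
    and conv: "conv_in_distr P (\<lambda>n \<omega>. sqrt (real n) *\<^sub>R (\<theta> n \<omega> - \<theta>\<^sub>0)) N"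
    using an by (auto simp: asymptotically_normal_def)
  \<comment> \<open>Here \<open>S\<close> is the whole space, so membership is trivial and the
    radius 1 is an arbitrary positive choice.\<close>
  have "conv_in_distr P (\<lambda>n \<omega>. sqrt (real n) *\<^sub>R (H (\<theta> n \<omega>) - H \<theta>\<^sub>0)) (distr N borel ((*v) ?J))"
    by (rule delta_method[OF assms(7) _ _ conv D zero_less_one])
      (use N meas in \<open>auto simp: multivariate_normal_def\<close>)
  moreover have "multivariate_normal (distr N borel ((*v) ?J)) 0
      ((2 * \<sigma>\<^sub>1) *\<^sub>R (?J ** matrix_inv G ** transpose ?J))"
    using multivariate_normal_linear_image[OF N, of ?J]
    by (simp only: congruence_annihilates_outer[OF Euler])
  ultimately show "asymptotically_normal P (\<lambda>n \<omega>. sqrt (real n) *\<^sub>R (H (\<theta> n \<omega>) - H \<theta>\<^sub>0))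
          ((2 * \<sigma>\<^sub>1) *\<^sub>R (?J ** matrix_inv G ** transpose ?J))"
    unfolding asymptotically_normal_def by blast
qed

end
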